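(* Let $\kappa>0$, $D_x>0$, $\beta\triangleq \kappa\ln 10/20$, and for positive integers $N,M$ define $$\gamma_{\mathrm{SWAN}}^{(\mathrm{SS})}(N,M)=\int_0^{D_x/M}\int_0^{D_x/N}\frac{MN}{D_x^2}\,10^{-\frac{\kappa}{10}x_{\mathrm t}}\,10^{-\frac{\kappa}{10}x_{\mathrm r}}\,\mathrm dx_{\mathrm t}\,\mathrm dx_{\mathrm r},\qquad \gamma_{\mathrm{PASS}}^{(\mathrm{SS})}=\int_0^{D_x}\int_0^{D_x}\frac{1}{D_x^2}\,10^{-\frac{\kappa}{10}x_{\mathrm t}}\,10^{-\frac{\kappa}{10}x_{\mathrm r}}\,\mathrm dx_{\mathrm t}\,\mathrm dx_{\mathrm r},$$ and $\eta^{(\mathrm{SS})}(N,M)=\gamma_{\mathrm{SWAN}}^{(\mathrm{SS})}(N,M)/\gamma_{\mathrm{PASS}}^{(\mathrm{SS})}$. Then $$\gamma_{\mathrm{SWAN}}^{(\mathrm{SS})}(N,M)=\frac{(1-e^{-2\beta D_x/M})(1-e^{-2\beta D_x/N})}{4\beta^2D_x^2/(MN)},\qquad \gamma_{\mathrm{PASS}}^{(\mathrm{SS})}=\frac{(1-e^{-2\beta D_x})^2}{4\beta^2D_x^2},$$ $$\eta^{(\mathrm{SS})}(N,M)=\frac{MN(1-e^{-2\beta D_x/M})(1-e^{-2\beta D_x/N})}{(1-e^{-2\beta D_x})^2}.$$ Moreover $\eta^{(\mathrm{SS})}(N,M)$ is increasing in $N$ and in $M$, $\lim_{M,N\to\infty}\gamma_{\mathrm{SWAN}}^{(\mathrm{SS})}(N,M)=1$,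 and $\eta^{(\mathrm{SS})}$ is upper bounded by its limit $$\lim_{M,N\to\infty}\eta^{(\mathrm{SS})}(N,M)=\frac{4\beta^2D_x^2}{(1-e^{-2\beta D_x})^2}.$$
   Context: A transmit and a receive dielectric waveguide of length $D_x$ are divided into $N$ and $M$ equal segments, respectively, each fed at one end; one pinching antenna on one selected segment is used on each side (segment selection). $\gamma_{\mathrm{SWAN}}^{(\mathrm{SS})}$ is the average in-waveguide power gain when the in-waveguide propagation distances on the two sides are independent and uniform on $[0,D_x/N]$ and $[0,D_x/M]$; $\gamma_{\mathrm{PASS}}^{(\mathrm{SS})}$ is the same quantity for unsegmented waveguides (distances uniform on $[0,D_x]$). $\kappa$ is the waveguide attenuation in dB/m. The ratio $\eta^{(\mathrm{SS})}$ is the gain of the segmented system over the unsegmented one. *)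

theory Defs
  imports "HOL-Analysis.Analysis"
begin

text \<open>
  \<open>\<kappa>\<close> is the waveguide attenuation in dB/m, \<open>D\<close> the waveguide length \<open>D\<^sub>x\<close>, and \<open>N\<close>, \<open>M\<close> the numbers
  of transmit and receive segments (only positive values are meaningful).
\<close>

definition gamma_SWAN_SS :: "real \<Rightarrow> real \<Rightarrow> nat \<Rightarrow> nat \<Rightarrow> real" where
  "gamma_SWAN_SS \<kappa> D N M =
     integral {0 .. D / real M} (\<lambda>x_r. integral {0 .. D / real N} (\<lambda>x_t.
       real M * real N / D\<^sup>2 * 10 powr (- (\<kappa> / 10) * x_t) * 10 powr (- (\<kappa> / 10) * x_r)))"

definition gamma_PASS_SS :: "real \<Rightarrow> real \<Rightarrow> real" where
  "gamma_PASS_SS \<kappa> D =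
     integral {0 .. D} (\<lambda>x_r. integral {0 .. D} (\<lambda>x_t.
       1 / D\<^sup>2 * 10 powr (- (\<kappa> / 10) * x_t) * 10 powr (- (\<kappa> / 10) * x_r)))"

definition eta_SS :: "real \<Rightarrow> real \<Rightarrow> nat \<Rightarrow> nat \<Rightarrow> real" where
  "eta_SS \<kappa> D N M = gamma_SWAN_SS \<kappa> D N M / gamma_PASS_SS \<kappa> D"

end

(*
With a = 2 \<beta> D and g x = x (1 - exp (-a/x)), the double integrals factor into gamma_SWAN = g N g M / a^2,
and so eta = g N g M / (g 1)^2. Everything then follows from three properties of g on (0, \<infinity>):
it is strictly increasing (its derivative is 1 - (1 + u) exp (-u) with u = a/x), it is bounded by a,
and it tends to a.
*)
theory Submission
  imports Defs "HOL-Real_Asymp.Real_Asymp"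
begin

lemma has_integral_exp_minus_mult:
  fixes c L :: real
  assumes "c \<noteq> 0" "0 \<le> L"
  shows "((\<lambda>x. exp (- c * x)) has_integral (1 - exp (- c * L)) / c) {0..L}"
proof -
  have "((\<lambda>x. exp (- c * x)) has_integral (- exp (- c * L) / c - (- exp (- c * 0) / c))) {0..L}"
  proof (rule fundamental_theorem_of_calculus)
    fix x :: real
    assume "x \<in> {0..L}"
    show "((\<lambda>x. - exp (- c * x) / c) has_vector_derivative exp (- c * x)) (at x within {0..L})"
      unfolding has_real_derivative_iff_has_vector_derivative [symmetric]
      using assms by (auto intro!: derivative_eq_intros)
  qed (use assms in auto)
  then show ?thesis
    by (simp add: diff_divide_distrib)
qed

text \<open>The integrand is a constant times a function of \<open>x\<close> times a function of
  \<open>y\<close>, so the double integral splits into two exponential integrals. The constant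
  \<open>k\<close> and the bounds stay free so that both average gains are instances.\<close>

lemma integral_powr_product:
  fixes k p c A B :: real
  assumes "c = p * ln 10" "c \<noteq> 0" "0 \<le> A" "0 \<le> B"
  shows "integral {0..A} (\<lambda>y. integral {0..B} (\<lambda>x. k * 10 powr (- p * x) * 10 powr (- p * y))) =
    k * ((1 - exp (- c * A)) / c) * ((1 - exp (- c * B)) / c)"
proof -
  have powr: "10 powr (- p * x) = exp (- c * x)" for x
    by (simp add: assms(1) powr_def mult_ac)
  have "integral {0..B} (\<lambda>x. exp (- c * x)) = (1 - exp (- c * B)) / c"
    "integral {0..A} (\<lambda>y. exp (- c * y)) = (1 - exp (- c * A)) / c"
    using assms has_integral_exp_minus_mult by (auto intro!: integral_unique)
  then show ?thesis
    unfolding powr by (simp only: integral_mult_left integral_mult_right mult_ac)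
qed

lemma mult_one_minus_exp_strict_mono:
  fixes a x y :: real
  assumes "0 < a" "0 < x" "x < y"
  shows "x * (1 - exp (- a / x)) < y * (1 - exp (- a / y))"
proof (rule DERIV_pos_imp_increasing [OF assms(3)])
  fix z
  assume "x \<le> z" "z \<le> y"
  then have z: "0 < z"
    using assms by simp
  \<comment> \<open>With \<open>u = a / z\<close>, positivity of the derivative
    \<open>1 - (1 + u) * exp (- u)\<close> is the strict inequality \<open>1 + u < exp u\<close>
    multiplied by \<open>exp (- u)\<close>; it is strict because \<open>u\<close> is
    nonzero.\<close>
  have "1 + a / z < exp (a / z)"
    using z assms exp_minus_greater [of "- (a / z)"] by simp
  then have "(1 + a / z) * exp (- (a / z)) < exp (a / z) * exp (- (a / z))"
    by simp
  then have "0 < 1 - exp (- a / z) - a / z * exp (- a / z)"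
    by (simp add: exp_minus field_simps)
  moreover have "((\<lambda>x. x * (1 - exp (- a / x))) has_real_derivative
      1 - exp (- a / z) - a / z * exp (- a / z)) (at z)"
    using z by (auto intro!: derivative_eq_intros simp: field_simps power2_eq_square)
  ultimately show "\<exists>d. ((\<lambda>x. x * (1 - exp (- a / x))) has_real_derivative d) (at z) \<and> 0 < d"
    by blast
qed

text \<open>The tangent bound \<open>1 + t \<le> exp t\<close> at \<open>t = - a / x\<close>,
  multiplied by \<open>x\<close>.\<close>

lemma mult_one_minus_exp_le:
  fixes a x :: real
  assumes "0 < x"
  shows "x * (1 - exp (- a / x)) \<le> a"
proof -
  have "1 - exp (- a / x) \<le> a / x"
    using exp_ge_add_one_self [of "- a / x"] by simp
  then show ?thesis
    using assms by (simp add: field_simps)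
qed

text \<open>To first order \<open>1 - exp (- a / n)\<close> behaves like \<open>a / n\<close>, so
  the product approaches the bound of the previous lemma.\<close>

lemma mult_one_minus_exp_tendsto:
  fixes a :: real
  assumes "0 < a"
  shows "(\<lambda>n. real n * (1 - exp (- a / real n))) \<longlonglongrightarrow> a"
  using assms by real_asymp

theorem mainTheorem1:
  fixes \<kappa> D \<beta> :: real
  assumes "\<kappa> > 0" and "D > 0" and "\<beta> = \<kappa> * ln 10 / 20"
  shows
    "(\<forall>N M. N > 0 \<and> M > 0 \<longrightarrow>
        gamma_SWAN_SS \<kappa> D N M =
          (1 - exp (- 2 * \<beta> * D / real M)) * (1 - exp (- 2 * \<beta> * D / real N))
            / (4 * \<beta>\<^sup>2 * D\<^sup>2 / (real M * real N))) \<and>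
     gamma_PASS_SS \<kappa> D = (1 - exp (- 2 * \<beta> * D))\<^sup>2 / (4 * \<beta>\<^sup>2 * D\<^sup>2) \<and>
     (\<forall>N M. N > 0 \<and> M > 0 \<longrightarrow>
        eta_SS \<kappa> D N M =
          real M * real N * (1 - exp (- 2 * \<beta> * D / real M)) * (1 - exp (- 2 * \<beta> * D / real N))
            / (1 - exp (- 2 * \<beta> * D))\<^sup>2) \<and>
     (\<forall>M>0. strict_mono_on {0<..} (\<lambda>N. eta_SS \<kappa> D N M)) \<and>
     (\<forall>N>0. strict_mono_on {0<..} (\<lambda>M. eta_SS \<kappa> D N M)) \<and>
     ((\<lambda>(N, M). gamma_SWAN_SS \<kappa> D N M) \<longlongrightarrow> 1) (sequentially \<times>\<^sub>F sequentially) \<and>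
     ((\<lambda>(N, M). eta_SS \<kappa> D N M) \<longlongrightarrow> 4 * \<beta>\<^sup>2 * D\<^sup>2 / (1 - exp (- 2 * \<beta> * D))\<^sup>2)
        (sequentially \<times>\<^sub>F sequentially) \<and>
     (\<forall>N M. N > 0 \<and> M > 0 \<longrightarrow>
        eta_SS \<kappa> D N M \<le> 4 * \<beta>\<^sup>2 * D\<^sup>2 / (1 - exp (- 2 * \<beta> * D))\<^sup>2)"
proof -
  \<comment> \<open>\<open>a\<close> is the decay exponent over the full length,
    \<open>g n / a\<close> is the mean of the decay factor over one of \<open>n\<close> segments,
    and \<open>e\<close> is the square of \<open>g 1\<close>.\<close>
  define a where "a = 2 * \<beta> * D"
  define g where "g x = x * (1 - exp (- a / x))" for x :: real
  define e where "e = (1 - exp (- a))\<^sup>2"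
  have \<beta>: "0 < \<beta>"
    unfolding assms(3) using assms(1) by simp
  have a: "0 < a"
    using \<beta> assms(2) by (simp add: a_def)
  have e: "0 < e"
    using a by (simp add: e_def)
  have ga: "- 2 * \<beta> * D / x = - a / x" "- 2 * \<beta> * D = - a" "4 * \<beta>\<^sup>2 * D\<^sup>2 = a\<^sup>2" for x
    by (simp_all add: a_def power2_eq_square mult_ac)
  \<comment> \<open>The 20 in \<beta>, against the 10 in the integrand, makes
    \<open>2 * \<beta>\<close> the natural decay rate.\<close>
  have c: "2 * \<beta> = \<kappa> / 10 * ln 10" "2 * \<beta> \<noteq> 0"
    using assms \<beta> by simp_all
  \<comment> \<open>This holds also when \<open>N\<close> or \<open>M\<close> is 0, both sides then
    being 0, so the limits below can rewrite with it unconditionally.\<close>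
  have swan: "gamma_SWAN_SS \<kappa> D N M = g (real N) * g (real M) / a\<^sup>2" for N M
    unfolding gamma_SWAN_SS_def
    using assms \<beta> by (subst integral_powr_product [OF c]) (simp_all add: g_def a_def power2_eq_square mult_ac)
  have pass: "gamma_PASS_SS \<kappa> D = e / a\<^sup>2"
    unfolding gamma_PASS_SS_def
    using assms \<beta> by (subst integral_powr_product [OF c]) (simp_all add: e_def a_def power2_eq_square mult_ac)
  have eta: "eta_SS \<kappa> D N M = g (real N) * g (real M) / e" for N M
    using a e by (simp add: eta_SS_def swan pass)
  have g_mono: "g (real m) < g (real n)" if "0 < m" "m < n" for m n
    unfolding g_def using that a by (intro mult_one_minus_exp_strict_mono) simp_all
  have g_pos: "0 < g (real n)" if "0 < n" for n
    using that a by (simp add: g_def)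
  have g_le: "g (real n) \<le> a" if "0 < n" for n
    using that mult_one_minus_exp_le [of "real n" a] by (simp add: g_def)
  have g_lim: "(\<lambda>n. g (real n)) \<longlonglongrightarrow> a"
    unfolding g_def using a by (rule mult_one_minus_exp_tendsto)
  \<comment> \<open>Each factor depends on one coordinate only, so the joint limit follows from
    \<open>g_lim\<close> along the projections. Taking \<open>d\<close> as \<open>a\<^sup>2\<close>
    gives the limit of the gain, and \<open>d = e\<close> that of the ratio.\<close>
  have lim: "((\<lambda>(N, M). g (real N) * g (real M) / d) \<longlongrightarrow> a\<^sup>2 / d) (sequentially \<times>\<^sub>F sequentially)"
    if "d \<noteq> 0" for d
    unfolding case_prod_beta power2_eq_square
    using that
    by (intro tendsto_intros filterlim_compose [OF g_lim] filterlim_fst filterlim_snd)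
  show ?thesis
    unfolding ga e_def [symmetric]
  proof (intro conjI allI impI)
    show "((\<lambda>(N, M). gamma_SWAN_SS \<kappa> D N M) \<longlongrightarrow> 1) (sequentially \<times>\<^sub>F sequentially)"
      using lim [of "a\<^sup>2"] a by (simp add: swan)
    show "((\<lambda>(N, M). eta_SS \<kappa> D N M) \<longlongrightarrow> a\<^sup>2 / e) (sequentially \<times>\<^sub>F sequentially)"
      using lim [of e] e by (simp add: eta)
    \<comment> \<open>The fixed factor \<open>g M\<close> is positive, which keeps the inequality
      strict.\<close>
    show "strict_mono_on {0<..} (\<lambda>N. eta_SS \<kappa> D N M)" if "0 < M" for M
      using that e by (auto intro!: strict_mono_onI divide_strict_right_mono mult_strict_right_mono
          simp: eta g_mono g_pos)
    show "strict_mono_on {0<..} (\<lambda>M. eta_SS \<kappa> D N M)" if "0 < N" for N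
      using that e by (auto intro!: strict_mono_onI divide_strict_right_mono mult_strict_left_mono
          simp: eta g_mono g_pos)
    \<comment> \<open>Each factor is at most \<open>a\<close>; multiplying the two bounds uses that
      \<open>a\<close> and \<open>g M\<close> are nonnegative.\<close>
    show "eta_SS \<kappa> D N M \<le> a\<^sup>2 / e" if "0 < N \<and> 0 < M" for N M
      using that a e g_pos [of M] unfolding eta power2_eq_square
      by (intro divide_right_mono mult_mono g_le) auto
  qed (use a e in \<open>simp_all add: swan eta pass g_def\<close>)
qed

end
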